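(* Let $\mathcal H$ be a Hilbert function space on a set $\Omega$ and let $\varphi$ be a pseudomultiplier of $\mathcal H$. Then the polar space $\mathcal P_\varphi$ is a closed subspace of $\mathcal H$ and $$\mathcal S_\varphi=\mathcal P_\varphi\oplus\mathcal A_\varphi$$ (orthogonal direct sum), where $\mathcal S_\varphi=E_\varphi^\perp$ is the singular space of $\varphi$ and $\mathcal A_\varphi$ is the set of ambiguous vectors of $\varphi$.
   Context: A Hilbert function space on a set $\Omega$ is a complex Hilbert space $\mathcal H$ whose elements are complex-valued functions on $\Omega$ (with pointwise operations) such that for each $\lambda\in\Omega$ the functional $f\mapsto f(\lambda)$ is continuous. A subset $D\subset\Omega$ is a set of uniqueness for $\mathcal H$ if any $f,g\in\mathcal H$ that agree on $D$ are equal. A function $\varphi:D_\varphi\subset\Omega\to\mathbb C$ is a pseudomultiplier of $\mathcal H$ if (1) $D_\varphi$ is a set of uniqueness for $\mathcal H$; (2) $E_\varphi=\{h\in\mathcal H:\text{ there exists } g\in\mathcal H \text{ with } g(\lambda)=\varphi(\lambda)h(\lambda)\text{ for all }\lambda\in D_\varphi\}$ is closed in $\mathcal H$; (3) $E_\varphi$ has finite codimension in $\mathcal H$. The singular space is $\mathcal S_\varphi=E_\varphi^\perp$. Seeing a vector: for $v\in\mathcal H$, let $p\notin\Omega$, and for $f\in\mathcal H$ define $f_v:\Omega\cup\{p\}\to\mathbb C$ by $f_v=f$ on $\Omega$ and $f_v(p)=\langle f,v\rangle$. Let $\mathcal H_v=\{f_v:f\in\mathcal H\}$ with $\langle f_v,g_v\rangle_{\mathcal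 H_v}=\langle f,g\rangle_{\mathcal H}$; this is a Hilbert function space on $\Omega\cup\{p\}$. The pseudomultiplier $\varphi$ of $\mathcal H$ sees $v$ with value $c\in\mathbb C$ if there exists a pseudomultiplier $\psi$ of $\mathcal H_v$ such that $D_\varphi\subseteq D_\psi$, $\psi|D_\varphi=\varphi$, $p\in D_\psi$, $E_\varphi=E_\psi|\Omega:=\{F|\Omega:F\in E_\psi\}$, and $\psi(p)=c$. $\varphi$ sees $v$ if it sees $v$ with some value $c$. Ambiguous vectors: $\mathcal A_\varphi$ is the set of $v\in\mathcal H$ such that $\varphi$ sees $v$ with value $c$ for every $c\in\mathbb C$. Definable vectors: $d\in\mathcal H$ is definable for $\varphi$ if $d\neq0$, $\varphi$ sees $d$, and $d\perp\mathcal A_\varphi$; $\mathbf D_\varphi$ is the set of definable vectors. For $d\in\mathbf D_\varphi$ there is a unique $c\in\mathbb C$ such that $\varphi$ sees $d$ with value $c$; it is denoted $\varphi(d)$. Polar vectors: $q\in\mathcal H$ is a polar vector for $\varphi$ if $q\ne0$ and there is a sequence $(d_n)$ in $\mathbf D_\varphi$ with $d_n\to q$ in norm and $\varphi(d_n)\to\infty$ (i.e. $|\varphi(d_n)|\to\infty$). The polar space $\mathcal P_\varphi$ is the set consisting of the polar vectors of $\varphi$ together with $0$. *)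

theory Defs
  imports "HOL-Analysis.Analysis" "HOL-Library.Function_Algebras"
begin

definition cscale :: "complex \<Rightarrow> ('a \<Rightarrow> complex) \<Rightarrow> 'a \<Rightarrow> complex" where
  "cscale c f = (\<lambda>x. c * f x)"

interpretation cfun: vector_space "cscale :: complex \<Rightarrow> ('a \<Rightarrow> complex) \<Rightarrow> 'a \<Rightarrow> complex"
  by standard (auto simp: cscale_def fun_eq_iff algebra_simps)

text \<open>
  A function on \<open>pts H\<close> is represented by the total function that extends it by \<open>0\<close>, so that
  equality of representatives is equality on \<open>pts H\<close> and the operations of
  \<^theory>\<open>HOL-Library.Function_Algebras\<close> are the pointwise ones. The inner product is linear in
  its first argument.
\<close>

record 'a hfs =
  pts :: "'a set"
  fns :: "('a \<Rightarrow> complex) set"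
  ip :: "('a \<Rightarrow> complex) \<Rightarrow> ('a \<Rightarrow> complex) \<Rightarrow> complex"

text \<open>The value \<open>0\<close> off \<open>fns H\<close> is immaterial: \<^locale>\<open>Metric_space\<close> asks for
  nonnegativity and symmetry on the whole type.\<close>

definition hdist :: "'a hfs \<Rightarrow> ('a \<Rightarrow> complex) \<Rightarrow> ('a \<Rightarrow> complex) \<Rightarrow> real" where
  "hdist H f g =
     (if f \<in> fns H \<and> g \<in> fns H then sqrt (Re (ip H (f - g) (f - g))) else 0)"

abbreviation htop :: "'a hfs \<Rightarrow> ('a \<Rightarrow> complex) topology" where
  "htop H \<equiv> Metric_space.mtopology (fns H) (hdist H)"

locale hilbert_function_space =
  fixes H :: "'a hfs"
  assumes zero_outside: "\<And>f x. f \<in> fns H \<Longrightarrow> x \<notin> pts H \<Longrightarrow> f x = 0"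
    and subspace: "cfun.subspace (fns H)"
    and ip_add: "\<And>f g h. f \<in> fns H \<Longrightarrow> g \<in> fns H \<Longrightarrow> h \<in> fns H \<Longrightarrow>
        ip H (f + g) h = ip H f h + ip H g h"
    and ip_scale: "\<And>c f h. f \<in> fns H \<Longrightarrow> h \<in> fns H \<Longrightarrow> ip H (cscale c f) h = c * ip H f h"
    and ip_cnj: "\<And>f g. f \<in> fns H \<Longrightarrow> g \<in> fns H \<Longrightarrow> ip H g f = cnj (ip H f g)"
    and ip_nonneg: "\<And>f. f \<in> fns H \<Longrightarrow> 0 \<le> Re (ip H f f)"
    and ip_definite: "\<And>f. f \<in> fns H \<Longrightarrow> ip H f f = 0 \<Longrightarrow> f = 0"
    and complete: "Metric_space.mcomplete (fns H) (hdist H)"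
    and continuous_eval: "\<And>x. x \<in> pts H \<Longrightarrow> continuous_map (htop H) euclidean (\<lambda>f. f x)"

definition closed_subspace :: "'a hfs \<Rightarrow> ('a \<Rightarrow> complex) set \<Rightarrow> bool" where
  "closed_subspace H V \<longleftrightarrow> V \<subseteq> fns H \<and> cfun.subspace V \<and> closedin (htop H) V"

definition finite_codimension :: "'a hfs \<Rightarrow> ('a \<Rightarrow> complex) set \<Rightarrow> bool" where
  "finite_codimension H V \<longleftrightarrow> (\<exists>B. finite B \<and> B \<subseteq> fns H \<and> fns H \<subseteq> cfun.span (V \<union> B))"

definition orth_complement :: "'a hfs \<Rightarrow> ('a \<Rightarrow> complex) set \<Rightarrow> ('a \<Rightarrow> complex) set" where
  "orth_complement H V = {f \<in> fns H. \<forall>g\<in>V. ip H f g = 0}"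

definition orthogonal_direct_sum ::
  "'a hfs \<Rightarrow> ('a \<Rightarrow> complex) set \<Rightarrow> ('a \<Rightarrow> complex) set \<Rightarrow> ('a \<Rightarrow> complex) set \<Rightarrow> bool" where
  "orthogonal_direct_sum H S V W \<longleftrightarrow>
     closed_subspace H V \<and> closed_subspace H W \<and>
     (\<forall>f\<in>V. \<forall>g\<in>W. ip H f g = 0) \<and> S = {f + g |f g. f \<in> V \<and> g \<in> W}"

definition uniqueness_set :: "'a hfs \<Rightarrow> 'a set \<Rightarrow> bool" where
  "uniqueness_set H D \<longleftrightarrow> D \<subseteq> pts H \<and>
     (\<forall>f\<in>fns H. \<forall>g\<in>fns H. (\<forall>x\<in>D. f x = g x) \<longrightarrow> f = g)"

text \<open>A function \<open>\<phi>\<close> with domain \<open>D\<close> is a partial map with \<open>dom \<phi> = D\<close>.\<close>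

definition mult_dom :: "'a hfs \<Rightarrow> ('a \<rightharpoonup> complex) \<Rightarrow> ('a \<Rightarrow> complex) set" where
  "mult_dom H \<phi> = {h \<in> fns H. \<exists>g\<in>fns H. \<forall>x\<in>dom \<phi>. g x = the (\<phi> x) * h x}"

definition pseudomultiplier :: "'a hfs \<Rightarrow> ('a \<rightharpoonup> complex) \<Rightarrow> bool" where
  "pseudomultiplier H \<phi> \<longleftrightarrow> uniqueness_set H (dom \<phi>) \<and>
     closedin (htop H) (mult_dom H \<phi>) \<and> finite_codimension H (mult_dom H \<phi>)"

definition singular_space :: "'a hfs \<Rightarrow> ('a \<rightharpoonup> complex) \<Rightarrow> ('a \<Rightarrow> complex) set" where
  "singular_space H \<phi> = orth_complement H (mult_dom H \<phi>)"

text \<open>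
  The space \<open>H\<^sub>v\<close>: the extra point is \<^term>\<open>None\<close>, the old points are \<open>Some x\<close>, and
  restriction to the old points is \<open>\<lambda>F. F \<circ> Some\<close>.
\<close>

definition extend_fn :: "'a hfs \<Rightarrow> ('a \<Rightarrow> complex) \<Rightarrow> ('a \<Rightarrow> complex) \<Rightarrow> 'a option \<Rightarrow> complex" where
  "extend_fn H v f = case_option (ip H f v) f"

definition extend_space :: "'a hfs \<Rightarrow> ('a \<Rightarrow> complex) \<Rightarrow> 'a option hfs" where
  "extend_space H v =
     \<lparr>pts = insert None (Some ` pts H),
      fns = extend_fn H v ` fns H,
      ip = (\<lambda>F G. ip H (F \<circ> Some) (G \<circ> Some))\<rparr>"

definition sees_with_value ::
  "'a hfs \<Rightarrow> ('a \<rightharpoonup> complex) \<Rightarrow> ('a \<Rightarrow> complex) \<Rightarrow> complex \<Rightarrow> bool" where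
  "sees_with_value H \<phi> v c \<longleftrightarrow>
     (\<exists>\<psi>. pseudomultiplier (extend_space H v) \<psi> \<and>
          (\<forall>x\<in>dom \<phi>. \<psi> (Some x) = \<phi> x) \<and>
          mult_dom H \<phi> = (\<lambda>F. F \<circ> Some) ` mult_dom (extend_space H v) \<psi> \<and>
          \<psi> None = Some c)"

definition ambiguous_vectors :: "'a hfs \<Rightarrow> ('a \<rightharpoonup> complex) \<Rightarrow> ('a \<Rightarrow> complex) set" where
  "ambiguous_vectors H \<phi> = {v \<in> fns H. \<forall>c. sees_with_value H \<phi> v c}"

definition definable_vectors :: "'a hfs \<Rightarrow> ('a \<rightharpoonup> complex) \<Rightarrow> ('a \<Rightarrow> complex) set" where
  "definable_vectors H \<phi> =
     {d \<in> fns H. d \<noteq> 0 \<and> (\<exists>c. sees_with_value H \<phi> d c) \<and>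
        (\<forall>a\<in>ambiguous_vectors H \<phi>. ip H d a = 0)}"

definition vector_value :: "'a hfs \<Rightarrow> ('a \<rightharpoonup> complex) \<Rightarrow> ('a \<Rightarrow> complex) \<Rightarrow> complex" where
  "vector_value H \<phi> d = (THE c. sees_with_value H \<phi> d c)"

definition polar_vector :: "'a hfs \<Rightarrow> ('a \<rightharpoonup> complex) \<Rightarrow> ('a \<Rightarrow> complex) \<Rightarrow> bool" where
  "polar_vector H \<phi> q \<longleftrightarrow> q \<in> fns H \<and> q \<noteq> 0 \<and>
     (\<exists>d :: nat \<Rightarrow> 'a \<Rightarrow> complex. (\<forall>n. d n \<in> definable_vectors H \<phi>) \<and>
        limitin (htop H) d q sequentially \<and>
        filterlim (\<lambda>n. vector_value H \<phi> (d n)) at_infinity sequentially)"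

definition polar_space :: "'a hfs \<Rightarrow> ('a \<rightharpoonup> complex) \<Rightarrow> ('a \<Rightarrow> complex) set" where
  "polar_space H \<phi> = insert 0 {q. polar_vector H \<phi> q}"

end

theory Submission
  imports Defs
begin

text \<open>
  Write \<open>E\<close> for the space on which multiplication by \<open>\<phi>\<close> acts and \<open>M: E \<rightarrow> H\<close> for the
  multiplication operator, so that \<open>E\<^sup>\<bottom>\<close> is the singular space. Everything follows from a
  description of the notions involved as eigenvalue conditions. A vector \<open>v\<close> is seen with value \<open>c\<close>
  iff \<open>\<langle>M h, v\<rangle> = c * \<langle>h, v\<rangle>\<close> for all \<open>h\<close> in \<open>E\<close> (\<open>sees_with_value_iff\<close>). Two different values force
  both inner products to vanish, so the ambiguous space is \<open>A = (E + M E)\<^sup>\<bottom>\<close>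
  (\<open>ambiguous_vectors_eq\<close>), a closed subspace of \<open>E\<^sup>\<bottom>\<close>. It remains to identify the polar space with
  the part of \<open>E\<^sup>\<bottom>\<close> orthogonal to \<open>A\<close> (\<open>polar_space_eq\<close>); the decomposition is then the projection
  theorem.

  A polar vector \<open>q\<close> lies in \<open>E\<^sup>\<bottom>\<close>: dividing the eigenvalue condition for \<open>d\<^sub>n\<close> by its value
  \<open>c\<^sub>n \<rightarrow> \<infinity>\<close> shows that \<open>\<langle>h, d\<^sub>n\<rangle> \<rightarrow> 0\<close>. Conversely, the vectors seen with value \<open>c\<close> are the
  orthogonal complement of \<open>(M - c) E\<close>, so the component of \<open>q\<close> in that complement is a candidate
  for a definable vector near \<open>q\<close>, provided that the projection of \<open>q\<close> to the closure of
  \<open>(M - c) E\<close> tends to \<open>0\<close> as \<open>c \<rightarrow> \<infinity>\<close>. For \<open>q\<close> in \<open>E\<^sup>\<bottom>\<close> this follows from the boundedness of \<open>M\<close>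
  (\<open>exists_definable_near\<close>).

  Boundedness is the closed graph theorem in this setting (\<open>mult_graph_bounded\<close>). It follows from
  Baire's theorem, since the adjoint of \<open>M\<close> is densely defined: its domain contains the reproducing
  kernels at the points of the set of uniqueness \<open>dom \<phi>\<close>.
\<close>

section \<open>Geometry of a Hilbert function space\<close>

definition hnorm :: "'a hfs \<Rightarrow> ('a \<Rightarrow> complex) \<Rightarrow> real" where
  "hnorm H f = sqrt (Re (ip H f f))"

context hilbert_function_space
begin

lemma zero_mem [simp]: "0 \<in> fns H"
  by (rule cfun.subspace_0[OF subspace])

lemma add_mem [simp]: "f \<in> fns H \<Longrightarrow> g \<in> fns H \<Longrightarrow> f + g \<in> fns H"
  by (rule cfun.subspace_add[OF subspace])

lemma diff_mem [simp]: "f \<in> fns H \<Longrightarrow> g \<in> fns H \<Longrightarrow> f - g \<in> fns H"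
  by (rule cfun.subspace_diff[OF subspace])

lemma cscale_mem [simp]: "f \<in> fns H \<Longrightarrow> cscale c f \<in> fns H"
  by (rule cfun.subspace_scale[OF subspace])

lemma ip_zero_left [simp]: "h \<in> fns H \<Longrightarrow> ip H 0 h = 0"
  using ip_add[of 0 0 h] by simp

lemma ip_zero_right [simp]: "h \<in> fns H \<Longrightarrow> ip H h 0 = 0"
  using ip_cnj[of 0 h] by simp

lemma ip_diff:
  assumes "f \<in> fns H" "g \<in> fns H" "h \<in> fns H"
  shows "ip H (f - g) h = ip H f h - ip H g h"
  using ip_add[of "f - g" g h] assms by (simp add: algebra_simps)

lemma ip_add_right:
  assumes "f \<in> fns H" "g \<in> fns H" "h \<in> fns H"
  shows "ip H h (f + g) = ip H h f + ip H h g"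
  using ip_cnj[of "f + g" h] ip_cnj[of f h] ip_cnj[of g h] ip_add[of f g h] assms by simp

lemma ip_diff_right:
  assumes "f \<in> fns H" "g \<in> fns H" "h \<in> fns H"
  shows "ip H h (f - g) = ip H h f - ip H h g"
  using ip_add_right[of "f - g" g h] assms by (simp add: algebra_simps)

lemma ip_scale_right:
  assumes "f \<in> fns H" "h \<in> fns H"
  shows "ip H h (cscale c f) = cnj c * ip H h f"
  using ip_cnj[of "cscale c f" h] ip_cnj[of f h] ip_scale[of f h c] assms by simp

lemma ip_eq_zero_sym: "f \<in> fns H \<Longrightarrow> g \<in> fns H \<Longrightarrow> ip H f g = 0 \<longleftrightarrow> ip H g f = 0"
  using ip_cnj[of f g] by auto

lemma norm_ip_commute: "f \<in> fns H \<Longrightarrow> g \<in> fns H \<Longrightarrow> norm (ip H f g) = norm (ip H g f)"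
  using ip_cnj[of f g] by simp

lemma hnorm_nonneg: "f \<in> fns H \<Longrightarrow> 0 \<le> hnorm H f"
  by (simp add: hnorm_def ip_nonneg)

lemma ip_self: "f \<in> fns H \<Longrightarrow> ip H f f = complex_of_real ((hnorm H f)\<^sup>2)"
  using ip_cnj[of f f] ip_nonneg[of f]
  by (auto simp: hnorm_def complex_eq_iff)

lemma hnorm_eq_zero: "f \<in> fns H \<Longrightarrow> hnorm H f = 0 \<longleftrightarrow> f = 0"
  using ip_self[of f] ip_definite[of f] by (auto simp: hnorm_def)

lemma hnorm_cscale:
  assumes "f \<in> fns H"
  shows "hnorm H (cscale c f) = norm c * hnorm H f"
proof -
  have "ip H (cscale c f) (cscale c f) = (c * cnj c) * ip H f f"
    using assms by (simp add: ip_scale ip_scale_right)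
  also have "\<dots> = complex_of_real ((norm c * hnorm H f)\<^sup>2)"
    using assms by (simp add: ip_self complex_norm_square[symmetric] power_mult_distrib)
  finally show ?thesis
    using assms by (simp add: hnorm_def[of H "cscale c f"] hnorm_nonneg)
qed

lemma hnorm_diff_commute:
  assumes "f \<in> fns H" "g \<in> fns H"
  shows "hnorm H (f - g) = hnorm H (g - f)"
proof -
  have "cscale (- 1) (f - g) = g - f" by (auto simp: cscale_def)
  then show ?thesis
    using hnorm_cscale[of "f - g" "- 1"] assms by simp
qed

lemma hnorm_diff_cscale_sq:
  assumes "f \<in> fns H" "g \<in> fns H"
  shows "(hnorm H (f - cscale c g))\<^sup>2 =
    (hnorm H f)\<^sup>2 - 2 * Re (cnj c * ip H f g) + (norm c)\<^sup>2 * (hnorm H g)\<^sup>2"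
proof -
  have "complex_of_real ((hnorm H (f - cscale c g))\<^sup>2) = ip H (f - cscale c g) (f - cscale c g)"
    using assms by (simp add: ip_self)
  also have "\<dots> = ip H f f - (cnj c * ip H f g + cnj (cnj c * ip H f g)) + (c * cnj c) * ip H g g"
    using assms ip_cnj[of f g] by (simp add: ip_diff ip_diff_right ip_scale ip_scale_right algebra_simps)
  also have "\<dots> = complex_of_real
      ((hnorm H f)\<^sup>2 - 2 * Re (cnj c * ip H f g) + (norm c)\<^sup>2 * (hnorm H g)\<^sup>2)"
    using assms by (simp only: complex_add_cnj ip_self complex_norm_square[symmetric]) simp
  finally show ?thesis
    by (simp only: of_real_eq_iff)
qed

text \<open>Subtracting from \<open>f\<close> its component along \<open>g\<close> lowers the squared norm by exactly the square of
  the length of that component. This yields the Cauchy--Schwarz inequality and also turns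
  near-minimality of a distance into near-orthogonality in the projection lemma.\<close>

lemma exists_cscale_hnorm_diff_sq:
  assumes "f \<in> fns H" "g \<in> fns H"
  obtains c where
    "(hnorm H (f - cscale c g))\<^sup>2 * (hnorm H g)\<^sup>2 = (hnorm H f)\<^sup>2 * (hnorm H g)\<^sup>2 - (norm (ip H f g))\<^sup>2"
proof (cases "g = 0")
  case True
  then show ?thesis using that[of 0] assms hnorm_eq_zero[of 0] by simp
next
  case False
  define N where "N = (hnorm H g)\<^sup>2"
  have N: "N \<noteq> 0" using False assms by (simp add: N_def hnorm_eq_zero)
  define c where "c = ip H f g / complex_of_real N"
  have 1: "Re (cnj c * ip H f g) = (norm (ip H f g))\<^sup>2 / N"
    by (simp add: c_def cmod_power2) (simp add: power2_eq_square add_divide_distrib)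
  have 2: "(norm c)\<^sup>2 * N = (norm (ip H f g))\<^sup>2 / N"
    using N by (simp add: c_def norm_divide power_divide power2_eq_square)
  have "(hnorm H (f - cscale c g))\<^sup>2 = (hnorm H f)\<^sup>2 - (norm (ip H f g))\<^sup>2 / N"
    using hnorm_diff_cscale_sq[OF assms, of c] 1 2 unfolding N_def by simp
  then have "(hnorm H (f - cscale c g))\<^sup>2 * N = (hnorm H f)\<^sup>2 * N - (norm (ip H f g))\<^sup>2"
    using N by (simp add: field_simps)
  then show ?thesis using that[of c] unfolding N_def by blast
qed

lemma cauchy_schwarz:
  assumes "f \<in> fns H" "g \<in> fns H"
  shows "norm (ip H f g) \<le> hnorm H f * hnorm H g"
proof -
  obtain c where "(hnorm H (f - cscale c g))\<^sup>2 * (hnorm H g)\<^sup>2 =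
      (hnorm H f)\<^sup>2 * (hnorm H g)\<^sup>2 - (norm (ip H f g))\<^sup>2"
    using exists_cscale_hnorm_diff_sq assms by blast
  moreover have "0 \<le> (hnorm H (f - cscale c g))\<^sup>2 * (hnorm H g)\<^sup>2" by simp
  ultimately have "(norm (ip H f g))\<^sup>2 \<le> (hnorm H f * hnorm H g)\<^sup>2"
    by (simp add: power_mult_distrib)
  then show ?thesis
    by (rule power2_le_imp_le) (use assms in \<open>auto simp: hnorm_nonneg\<close>)
qed

lemma hnorm_triangle:
  assumes "f \<in> fns H" "g \<in> fns H"
  shows "hnorm H (f + g) \<le> hnorm H f + hnorm H g"
proof -
  have eq: "f - cscale (- 1) g = f + g" by (auto simp: cscale_def)
  have "(hnorm H (f + g))\<^sup>2 = (hnorm H f)\<^sup>2 + 2 * Re (ip H f g) + (hnorm H g)\<^sup>2"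
    using hnorm_diff_cscale_sq[OF assms, of "- 1"] unfolding eq by simp
  also have "\<dots> \<le> (hnorm H f)\<^sup>2 + 2 * (hnorm H f * hnorm H g) + (hnorm H g)\<^sup>2"
    using cauchy_schwarz[OF assms] complex_Re_le_cmod[of "ip H f g"] by simp
  also have "\<dots> = (hnorm H f + hnorm H g)\<^sup>2"
    by (simp add: power2_eq_square algebra_simps)
  finally show ?thesis
    by (rule power2_le_imp_le) (use assms in \<open>auto simp: hnorm_nonneg\<close>)
qed

lemma parallelogram:
  assumes "f \<in> fns H" "g \<in> fns H"
  shows "(hnorm H (f - g))\<^sup>2 + (hnorm H (f + g))\<^sup>2 = 2 * (hnorm H f)\<^sup>2 + 2 * (hnorm H g)\<^sup>2"
proof -
  have plus: "f - cscale (- 1) g = f + g" by (auto simp: cscale_def)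
  have minus: "f - cscale 1 g = f - g" by simp
  show ?thesis
    using hnorm_diff_cscale_sq[OF assms, of "- 1", unfolded plus]
      hnorm_diff_cscale_sq[OF assms, of 1, unfolded minus] by simp
qed

lemma hdist_hnorm: "f \<in> fns H \<Longrightarrow> g \<in> fns H \<Longrightarrow> hdist H f g = hnorm H (f - g)"
  by (simp add: hdist_def hnorm_def)

lemma metric_space_hdist: "Metric_space (fns H) (hdist H)"
proof
  fix f g h
  show "0 \<le> hdist H f g"
    by (simp add: hdist_def ip_nonneg)
  show "hdist H f g = hdist H g f"
    using hnorm_diff_commute[of f g] by (auto simp: hdist_def hnorm_def)
  assume fg: "f \<in> fns H" "g \<in> fns H"
  show "hdist H f g = 0 \<longleftrightarrow> f = g"
    using fg hnorm_eq_zero[of "f - g"] by (auto simp: hdist_hnorm)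
  assume h: "h \<in> fns H"
  show "hdist H f h \<le> hdist H f g + hdist H g h"
    using hnorm_triangle[of "f - g" "g - h"] fg h by (simp add: hdist_hnorm)
qed

end

sublocale hilbert_function_space \<subseteq> Metric_space "fns H" "hdist H"
  by (rule metric_space_hdist)

context hilbert_function_space
begin

lemma continuous_map_lipschitz:
  fixes F :: "('a \<Rightarrow> complex) \<Rightarrow> 'b::metric_space"
  assumes "\<And>f g. f \<in> fns H \<Longrightarrow> g \<in> fns H \<Longrightarrow> dist (F f) (F g) \<le> K * hdist H f g"
  shows "continuous_map (htop H) euclidean F"
  unfolding continuous_map_def
proof (intro conjI allI impI)
  show "F \<in> topspace (htop H) \<rightarrow> topspace euclidean" by simp
  fix U :: "'b set" assume "openin euclidean U"
  then have U: "open U" by simp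
  show "openin (htop H) {x \<in> topspace (htop H). F x \<in> U}"
    unfolding openin_mtopology
  proof (intro conjI allI impI)
    fix f assume "f \<in> {x \<in> topspace (htop H). F x \<in> U}"
    then have f: "f \<in> fns H" "F f \<in> U" by auto
    then obtain e where e: "e > 0" "ball (F f) e \<subseteq> U"
      using U open_contains_ball by blast
    define r where "r = e / (\<bar>K\<bar> + 1)"
    have "F g \<in> U" if g: "g \<in> fns H" "hdist H f g < r" for g
    proof -
      have "dist (F f) (F g) \<le> K * hdist H f g" using assms f g by blast
      also have "\<dots> \<le> (\<bar>K\<bar> + 1) * hdist H f g"
        by (intro mult_right_mono) auto
      also have "\<dots> < e" using g by (simp add: r_def field_simps)
      finally show ?thesis using e by auto
    qed
    moreover have "r > 0" using e by (simp add: r_def)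
    ultimately show "\<exists>r>0. mball f r \<subseteq> {x \<in> topspace (htop H). F x \<in> U}"
      by (intro exI[of _ r]) auto
  qed auto
qed

lemma continuous_map_ip:
  assumes "k \<in> fns H"
  shows "continuous_map (htop H) euclidean (\<lambda>f. ip H f k)"
proof (rule continuous_map_lipschitz)
  fix f g assume "f \<in> fns H" "g \<in> fns H"
  then show "dist (ip H f k) (ip H g k) \<le> hnorm H k * hdist H f g"
    using cauchy_schwarz[of "f - g" k] assms
    by (simp add: dist_norm ip_diff hdist_hnorm mult.commute)
qed

lemma continuous_map_hnorm: "continuous_map (htop H) euclidean (hnorm H)"
proof (rule continuous_map_lipschitz)
  fix f g assume fg: "f \<in> fns H" "g \<in> fns H"
  then show "dist (hnorm H f) (hnorm H g) \<le> 1 * hdist H f g"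
    using hnorm_triangle[of "f - g" g] hnorm_triangle[of "g - f" f] hnorm_diff_commute[OF fg]
    by (simp add: dist_norm hdist_hnorm)
qed

lemma closedin_norm_ip_le:
  assumes "k \<in> fns H"
  shows "closedin (htop H) {f \<in> fns H. norm (ip H f k) \<le> K * hnorm H f + L}"
proof -
  have "continuous_map (htop H) euclidean (\<lambda>f. norm (ip H f k) - K * hnorm H f)"
    by (intro continuous_map_diff continuous_map_norm continuous_map_real_mult_left
        continuous_map_ip continuous_map_hnorm assms)
  then have "closedin (htop H)
      {f \<in> topspace (htop H). norm (ip H f k) - K * hnorm H f \<in> {..L}}"
    by (rule closedin_continuous_map_preimage) auto
  then show ?thesis by (simp add: algebra_simps)
qed

lemma tendsto_ip:
  assumes "limitin (htop H) x l sequentially" "k \<in> fns H"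
  shows "(\<lambda>n. ip H (x n) k) \<longlonglongrightarrow> ip H l k"
  using continuous_map_limit[OF continuous_map_ip[OF assms(2)] assms(1)]
  by (simp add: limitin_canonical_iff o_def)

lemma closed_subspace_orth_complement:
  assumes "V \<subseteq> fns H"
  shows "closed_subspace H (orth_complement H V)"
  unfolding closed_subspace_def
proof (intro conjI)
  show "orth_complement H V \<subseteq> fns H" by (auto simp: orth_complement_def)
  show "cfun.subspace (orth_complement H V)"
    using assms by (auto simp: cfun.subspace_def orth_complement_def ip_add ip_scale subset_iff)
  have "orth_complement H V = fns H \<inter> (\<Inter>g\<in>V. {f \<in> fns H. norm (ip H f g) \<le> 0 * hnorm H f + 0})"
    by (auto simp: orth_complement_def)
  also have "closedin (htop H) \<dots>"
  proof (cases "V = {}")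
    case True
    then show ?thesis using closedin_topspace[of "htop H"] by simp
  next
    case False
    then show ?thesis
      using assms closedin_topspace[of "htop H"]
      by (intro closedin_Int closedin_INT closedin_norm_ip_le) (auto simp: subset_iff)
  qed
  finally show "closedin (htop H) (orth_complement H V)" .
qed

text \<open>A minimizing sequence for the distance from \<open>q\<close> to \<open>V\<close> is Cauchy by the parallelogram law, and
  its limit is the projection of \<open>q\<close>. The subspace need not be closed: the projection is then the
  one onto its closure.\<close>

lemma projection_closure:
  assumes V: "cfun.subspace V" "V \<subseteq> fns H" and q: "q \<in> fns H"
  obtains r where "r \<in> htop H closure_of V" "r \<in> fns H" "\<And>v. v \<in> V \<Longrightarrow> ip H (q - r) v = 0"
proof -
  define m where "m = Inf ((\<lambda>v. (hnorm H (q - v))\<^sup>2) ` V)"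
  have V0: "0 \<in> V" using V cfun.subspace_0 by blast
  have bdd: "bdd_below ((\<lambda>v. (hnorm H (q - v))\<^sup>2) ` V)" by (rule bdd_belowI2[of _ 0]) simp
  have m_le: "m \<le> (hnorm H (q - v))\<^sup>2" if "v \<in> V" for v
    unfolding m_def using that bdd by (rule cINF_lower[rotated])
  have "\<exists>v\<in>V. (hnorm H (q - v))\<^sup>2 < m + 1 / Suc n" for n
  proof -
    have "m < m + 1 / Suc n" by simp
    then show ?thesis
      unfolding m_def using cINF_less_iff[OF _ bdd] V0 by blast
  qed
  then obtain x where x: "\<And>n. x n \<in> V" "\<And>n. (hnorm H (q - x n))\<^sup>2 < m + 1 / Suc n"
    by metis
  have xH: "x n \<in> fns H" for n using x V by auto
  have near: "(hnorm H (x i - x j))\<^sup>2 \<le> 2 / Suc i + 2 / Suc j" for i j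
  proof -
    define w where "w = cscale (1/2) (x i + x j)"
    have w: "w \<in> V" unfolding w_def using V x by (intro cfun.subspace_scale cfun.subspace_add) auto
    have wH: "w \<in> fns H" using w V by auto
    have "(q - x j) + (q - x i) = cscale 2 (q - w)"
      by (auto simp: w_def cscale_def fun_eq_iff algebra_simps)
    then have "(hnorm H ((q - x j) + (q - x i)))\<^sup>2 = 4 * (hnorm H (q - w))\<^sup>2"
      using q wH by (simp add: hnorm_cscale power_mult_distrib)
    moreover have "(q - x j) - (q - x i) = x i - x j" by simp
    ultimately have "(hnorm H (x i - x j))\<^sup>2 + 4 * (hnorm H (q - w))\<^sup>2 =
        2 * (hnorm H (q - x j))\<^sup>2 + 2 * (hnorm H (q - x i))\<^sup>2"
      using parallelogram[of "q - x j" "q - x i"] q xH by simp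
    then show ?thesis
      using m_le[OF w] x(2)[of i] x(2)[of j] by simp
  qed
  have "MCauchy x"
    unfolding MCauchy_def
  proof (intro conjI allI impI)
    show "range x \<subseteq> fns H" using xH by auto
    fix e :: real assume e: "e > 0"
    obtain N where N: "4 / e\<^sup>2 < real N" using reals_Archimedean2 by blast
    have "hdist H (x i) (x j) < e" if "N \<le> i" "N \<le> j" for i j
    proof -
      have "2 / real (Suc i) \<le> 2 / real (Suc N)" "2 / real (Suc j) \<le> 2 / real (Suc N)"
        using that by (auto intro!: divide_left_mono)
      then have "(hnorm H (x i - x j))\<^sup>2 \<le> 4 / real (Suc N)"
        using near[of i j] by simp
      also have "\<dots> < e\<^sup>2"
        using N e by (simp add: field_simps) (smt (verit) zero_less_power)
      finally have "hnorm H (x i - x j) < e"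
        by (rule power2_less_imp_less) (use e in simp)
      then show ?thesis using xH by (simp add: hdist_hnorm)
    qed
    then show "\<exists>N. \<forall>i j. N \<le> i \<longrightarrow> N \<le> j \<longrightarrow> hdist H (x i) (x j) < e" by blast
  qed
  then obtain r where r: "limitin (htop H) x r sequentially"
    using complete unfolding mcomplete_def by blast
  have rH: "r \<in> fns H" using r limitin_mspace by blast
  have "r \<in> htop H closure_of V"
    unfolding closure_of_sequentially using rH r x xH by auto
  moreover have "ip H (q - r) v = 0" if v: "v \<in> V" for v
  proof -
    have vH: "v \<in> fns H" using v V by auto
    have bound: "(norm (ip H (q - x n) v))\<^sup>2 \<le> (hnorm H v)\<^sup>2 * (1 / Suc n)" for n
    proof -
      obtain c where c: "(hnorm H (q - x n - cscale c v))\<^sup>2 * (hnorm H v)\<^sup>2 =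
          (hnorm H (q - x n))\<^sup>2 * (hnorm H v)\<^sup>2 - (norm (ip H (q - x n) v))\<^sup>2"
        using exists_cscale_hnorm_diff_sq[of "q - x n" v] q xH vH by auto
      have "m \<le> (hnorm H (q - (x n + cscale c v)))\<^sup>2"
        using V x v by (intro m_le cfun.subspace_scale cfun.subspace_add) auto
      then have "m * (hnorm H v)\<^sup>2 \<le> (hnorm H (q - x n - cscale c v))\<^sup>2 * (hnorm H v)\<^sup>2"
        by (intro mult_right_mono) (auto simp: diff_diff_eq)
      moreover have "(hnorm H (q - x n))\<^sup>2 * (hnorm H v)\<^sup>2 \<le> (m + 1 / Suc n) * (hnorm H v)\<^sup>2"
        using x(2)[of n] by (intro mult_right_mono) auto
      ultimately show ?thesis using c by (simp add: algebra_simps)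
    qed
    have "(\<lambda>n. (norm (ip H q v - ip H (x n) v))\<^sup>2) \<longlonglongrightarrow> (norm (ip H q v - ip H r v))\<^sup>2"
      by (intro tendsto_intros tendsto_ip[OF r vH])
    moreover have "(\<lambda>n. (hnorm H v)\<^sup>2 * (1 / real (Suc n))) \<longlonglongrightarrow> (hnorm H v)\<^sup>2 * 0"
      by (intro tendsto_mult tendsto_const LIMSEQ_Suc[OF lim_1_over_n])
    ultimately have "(norm (ip H q v - ip H r v))\<^sup>2 \<le> (hnorm H v)\<^sup>2 * 0"
      by (rule LIMSEQ_le) (use bound q xH vH in \<open>auto simp: ip_diff\<close>)
    then show ?thesis using q rH vH by (simp add: ip_diff)
  qed
  ultimately show ?thesis using that rH by blast
qed

text \<open>If some vector does not vanish at \<open>x\<close>, removing its projection to the kernel \<open>N\<close> of the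
  evaluation leaves a nonzero vector orthogonal to \<open>N\<close>. As \<open>N\<close> has codimension one, evaluation at
  \<open>x\<close> is the inner product with a multiple of that vector.\<close>

lemma reproducing_kernel:
  assumes x: "x \<in> pts H"
  obtains k where "k \<in> fns H" "\<And>f. f \<in> fns H \<Longrightarrow> ip H f k = f x"
proof (cases "\<forall>f\<in>fns H. f x = 0")
  case True
  then show ?thesis using that[of 0] by simp
next
  case False
  then obtain f0 where f0: "f0 \<in> fns H" "f0 x \<noteq> 0" by blast
  define N where "N = {f \<in> fns H. f x = 0}"
  have sub: "cfun.subspace N"
    by (auto simp: N_def cfun.subspace_def) (simp add: cscale_def)
  have "closedin (htop H) {f \<in> topspace (htop H). f x \<in> {0}}"
    by (rule closedin_continuous_map_preimage[OF continuous_eval[OF x]]) auto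
  then have clo: "htop H closure_of N = N" by (simp add: closure_of_eq N_def)
  have NH: "N \<subseteq> fns H" by (auto simp: N_def)
  obtain r where "r \<in> htop H closure_of N" "\<And>v. v \<in> N \<Longrightarrow> ip H (f0 - r) v = 0"
    using projection_closure[OF sub NH f0(1)] by metis
  then have r: "r \<in> N" "\<And>v. v \<in> N \<Longrightarrow> ip H (f0 - r) v = 0" using clo by auto
  define z where "z = f0 - r"
  have z: "z \<in> fns H" "z x \<noteq> 0" using f0 r(1) by (auto simp: z_def N_def)
  have z0: "ip H z z \<noteq> 0" using z ip_definite[of z] by auto
  define a where "a = z x / ip H z z"
  have "ip H f (cscale (cnj a) z) = f x" if f: "f \<in> fns H" for f
  proof -
    define b where "b = f x / z x"
    have "f - cscale b z \<in> N" using f z by (auto simp: N_def b_def) (simp add: cscale_def)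
    then have "ip H z (f - cscale b z) = 0" using r(2) z_def by blast
    then have "ip H (f - cscale b z) z = 0" using f z ip_eq_zero_sym by simp
    then have "ip H f z = b * ip H z z" using f z by (simp add: ip_diff ip_scale)
    then show ?thesis using f z z0 by (simp add: ip_scale_right a_def b_def)
  qed
  then show ?thesis using that[of "cscale (cnj a) z"] z by simp
qed

end

section \<open>The multiplication operator\<close>

text \<open>The multiplication operator is handled through its graph, a linear relation: the product with
  \<open>\<phi>\<close> is only prescribed on the domain of \<open>\<phi>\<close>, and a relation spares the choice of the function
  in \<open>fns H\<close> that extends it.\<close>

definition mult_graph ::
  "'a hfs \<Rightarrow> ('a \<rightharpoonup> complex) \<Rightarrow> (('a \<Rightarrow> complex) \<times> ('a \<Rightarrow> complex)) set" where
  "mult_graph H \<phi> =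
     {(h, g). h \<in> fns H \<and> g \<in> fns H \<and> (\<forall>x\<in>dom \<phi>. g x = the (\<phi> x) * h x)}"

definition adjoint_graph ::
  "'a hfs \<Rightarrow> ('a \<rightharpoonup> complex) \<Rightarrow> (('a \<Rightarrow> complex) \<times> ('a \<Rightarrow> complex)) set" where
  "adjoint_graph H \<phi> =
     {(w, k). w \<in> fns H \<and> k \<in> fns H \<and> (\<forall>(h, g)\<in>mult_graph H \<phi>. ip H g w = ip H h k)}"

lemma mult_dom_eq_Domain: "mult_dom H \<phi> = Domain (mult_graph H \<phi>)"
  by (auto simp: mult_dom_def mult_graph_def Domain_iff)

locale hilbert_function_space_pseudomultiplier = hilbert_function_space H
  for H :: "'a hfs" +
  fixes \<phi> :: "'a \<rightharpoonup> complex"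
  assumes pseudomultiplier: "pseudomultiplier H \<phi>"
begin

lemma mult_graph_mem:
  assumes "(h, g) \<in> mult_graph H \<phi>"
  shows "h \<in> fns H" "g \<in> fns H"
  using assms by (auto simp: mult_graph_def)

lemma adjoint_graphD:
  assumes "(w, k) \<in> adjoint_graph H \<phi>"
  shows "w \<in> fns H" "k \<in> fns H" "(h, g) \<in> mult_graph H \<phi> \<Longrightarrow> ip H g w = ip H h k"
  using assms by (auto simp: adjoint_graph_def)

lemma mult_graph_zero: "(0, 0) \<in> mult_graph H \<phi>"
  by (simp add: mult_graph_def)

lemma mult_graph_add:
  "(h, g) \<in> mult_graph H \<phi> \<Longrightarrow> (h', g') \<in> mult_graph H \<phi> \<Longrightarrow> (h + h', g + g') \<in> mult_graph H \<phi>"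
  by (auto simp: mult_graph_def algebra_simps)

lemma mult_graph_cscale:
  "(h, g) \<in> mult_graph H \<phi> \<Longrightarrow> (cscale c h, cscale c g) \<in> mult_graph H \<phi>"
  by (simp add: mult_graph_def) (simp add: cscale_def)

lemma dom_subset_pts: "dom \<phi> \<subseteq> pts H"
  and eq_on_dom_imp_eq:
    "f \<in> fns H \<Longrightarrow> g \<in> fns H \<Longrightarrow> (\<And>x. x \<in> dom \<phi> \<Longrightarrow> f x = g x) \<Longrightarrow> f = g"
  using pseudomultiplier unfolding pseudomultiplier_def uniqueness_set_def by blast+

lemma closedin_mult_dom: "closedin (htop H) (mult_dom H \<phi>)"
  using pseudomultiplier unfolding pseudomultiplier_def by blast

text \<open>The reproducing kernel at a point of the domain of \<open>\<phi>\<close> is an eigenvector of the adjoint, and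
  only \<open>0\<close> is orthogonal to all of these kernels because that domain is a set of uniqueness.\<close>

lemma closure_Domain_adjoint_graph: "htop H closure_of Domain (adjoint_graph H \<phi>) = fns H"
proof
  show "htop H closure_of Domain (adjoint_graph H \<phi>) \<subseteq> fns H"
    using closure_of_subset_topspace[of "htop H"] by simp
  have W: "cfun.subspace (Domain (adjoint_graph H \<phi>))"
    unfolding cfun.subspace_def
  proof (intro conjI allI ballI)
    show "0 \<in> Domain (adjoint_graph H \<phi>)"
      by (rule DomainI[of _ 0]) (auto simp: adjoint_graph_def mult_graph_def)
  next
    fix w w' assume "w \<in> Domain (adjoint_graph H \<phi>)" "w' \<in> Domain (adjoint_graph H \<phi>)"
    then obtain k k' where "(w, k) \<in> adjoint_graph H \<phi>" "(w', k') \<in> adjoint_graph H \<phi>" by blast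
    note wk = adjoint_graphD[OF this(1)] adjoint_graphD[OF this(2)]
    have "ip H g (w + w') = ip H h (k + k')" if hg: "(h, g) \<in> mult_graph H \<phi>" for h g
      using wk hg mult_graph_mem[OF hg] by (simp add: ip_add_right)
    then have "(w + w', k + k') \<in> adjoint_graph H \<phi>"
      using wk(1,2,4,5) by (auto simp: adjoint_graph_def)
    then show "w + w' \<in> Domain (adjoint_graph H \<phi>)" by blast
  next
    fix c w assume "w \<in> Domain (adjoint_graph H \<phi>)"
    then obtain k where "(w, k) \<in> adjoint_graph H \<phi>" by blast
    note wk = adjoint_graphD[OF this]
    have "ip H g (cscale c w) = ip H h (cscale c k)" if hg: "(h, g) \<in> mult_graph H \<phi>" for h g
      using wk hg mult_graph_mem[OF hg] by (simp add: ip_scale_right)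
    then have "(cscale c w, cscale c k) \<in> adjoint_graph H \<phi>"
      using wk(1,2) by (auto simp: adjoint_graph_def)
    then show "cscale c w \<in> Domain (adjoint_graph H \<phi>)" by blast
  qed
  have WH: "Domain (adjoint_graph H \<phi>) \<subseteq> fns H" by (auto simp: adjoint_graph_def)
  show "fns H \<subseteq> htop H closure_of Domain (adjoint_graph H \<phi>)"
  proof
    fix u assume u: "u \<in> fns H"
    obtain r where r: "r \<in> htop H closure_of Domain (adjoint_graph H \<phi>)" "r \<in> fns H"
      "\<And>w. w \<in> Domain (adjoint_graph H \<phi>) \<Longrightarrow> ip H (u - r) w = 0"
      using projection_closure[OF W WH u] by blast
    have "u x = r x" if x: "x \<in> dom \<phi>" for x
    proof -
      obtain k where k: "k \<in> fns H" "\<And>f. f \<in> fns H \<Longrightarrow> ip H f k = f x"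
        using reproducing_kernel dom_subset_pts x by blast
      have "(k, cscale (cnj (the (\<phi> x))) k) \<in> adjoint_graph H \<phi>"
        using k x by (auto simp: adjoint_graph_def mult_graph_def ip_scale_right)
      then have "ip H (u - r) k = 0" using r(3) by blast
      then show ?thesis using k(2)[of "u - r"] u r(2) by simp
    qed
    then have "u = r" using eq_on_dom_imp_eq u r(2) by blast
    then show "u \<in> htop H closure_of Domain (adjoint_graph H \<phi>)" using r by simp
  qed
qed

text \<open>A uniform boundedness argument. The vectors \<open>h\<close> on which the functionals \<open>\<langle>_, k\<rangle>\<close>, with
  \<open>(w, k)\<close> in the adjoint graph, are bounded by \<open>n * \<parallel>w\<parallel>\<close> form a closed set, and these sets exhaust
  the complete space on which the operator is defined. By Baire, one of them contains a ball.\<close>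

lemma adjoint_graph_bound:
  obtains C where "0 \<le> C"
    "\<And>h w k. h \<in> mult_dom H \<phi> \<Longrightarrow> (w, k) \<in> adjoint_graph H \<phi> \<Longrightarrow>
      norm (ip H h k) \<le> C * hnorm H h * hnorm H w"
proof -
  define E where "E = mult_dom H \<phi>"
  define F where "F n = {h \<in> E. \<forall>(w, k)\<in>adjoint_graph H \<phi>. norm (ip H h k) \<le> real n * hnorm H w}"
    for n
  have EH: "E \<subseteq> fns H" by (auto simp: E_def mult_dom_def)
  have cloE: "closedin (htop H) E" unfolding E_def by (rule closedin_mult_dom)
  note adj = adjoint_graphD(1,2)
  interpret S: Submetric "fns H" "hdist H" E
    by unfold_locales (rule EH)
  have "closedin (htop H) (F n)" for n
  proof -
    \<comment> \<open>The pair \<open>(0, 0)\<close> imposes no condition; it keeps the family of closed sets nonempty.\<close>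
    define G where "G p = {f \<in> fns H. norm (ip H f (snd p)) \<le> real n * hnorm H (fst p)}" for p
    have "closedin (htop H) (G p)" if "p \<in> insert (0, 0) (adjoint_graph H \<phi>)" for p
    proof -
      have "snd p \<in> fns H" using that adj(2) by (cases p) auto
      from closedin_norm_ip_le[OF this, of 0 "real n * hnorm H (fst p)"]
      show ?thesis by (simp add: G_def)
    qed
    then have "closedin (htop H) (E \<inter> (\<Inter>p\<in>insert (0, 0) (adjoint_graph H \<phi>). G p))"
      by (intro closedin_Int[OF cloE] closedin_INT) blast+
    moreover have "hnorm H 0 = 0" by (simp add: hnorm_eq_zero)
    then have "F n = E \<inter> (\<Inter>p\<in>insert (0, 0) (adjoint_graph H \<phi>). G p)"
      using EH by (fastforce simp: F_def G_def)
    ultimately show ?thesis by simp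
  qed
  then have closed: "closedin S.sub.mtopology (F n)" for n
    unfolding S.mtopology_submetric by (rule closedin_subset_topspace) (auto simp: F_def)
  have union: "(\<Union>n. F n) = E"
  proof (intro equalityI subsetI)
    fix h assume "h \<in> E"
    then obtain g where hg: "(h, g) \<in> mult_graph H \<phi>" unfolding E_def mult_dom_eq_Domain by blast
    obtain n where n: "hnorm H g \<le> real n" using real_arch_simple by blast
    have "norm (ip H h k) \<le> real n * hnorm H w" if wk: "(w, k) \<in> adjoint_graph H \<phi>" for w k
    proof -
      have "norm (ip H h k) = norm (ip H g w)" using hg wk by (auto simp: adjoint_graph_def)
      also have "\<dots> \<le> hnorm H g * hnorm H w"
        using cauchy_schwarz mult_graph_mem(2)[OF hg] adj(1)[OF wk] by blast
      also have "\<dots> \<le> real n * hnorm H w"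
        using n hnorm_nonneg[OF adj(1)[OF wk]] by (rule mult_right_mono)
      finally show ?thesis .
    qed
    then show "h \<in> (\<Union>n. F n)" using \<open>h \<in> E\<close> by (auto simp: F_def)
  qed (auto simp: F_def)
  have "\<exists>n. S.sub.mtopology interior_of F n \<noteq> {}"
  proof (rule ccontr)
    assume "\<not> ?thesis"
    then have "S.sub.mtopology interior_of \<Union>(range F) = {}"
      using closed S.closedin_mcomplete_imp_mcomplete[OF cloE complete]
      by (intro S.sub.metric_Baire_category_alt) auto
    then have "E = {}"
      using union interior_of_topspace[of S.sub.mtopology] by simp
    moreover have "0 \<in> E"
      unfolding E_def mult_dom_eq_Domain using mult_graph_zero by blast
    ultimately show False by blast
  qed
  then obtain n h0 e where h0: "h0 \<in> E" and e: "e > 0" and ball: "S.sub.mball h0 e \<subseteq> F n"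
    unfolding S.sub.metric_interior_of by auto
  have bound: "norm (ip H h k) \<le> (4 * real n / e) * hnorm H h * hnorm H w"
    if h: "h \<in> E" and wk: "(w, k) \<in> adjoint_graph H \<phi>" for h w k
  proof (cases "h = 0")
    case True
    have "hnorm H 0 = 0" by (simp add: hnorm_eq_zero)
    then show ?thesis using True adj(2)[OF wk] by simp
  next
    case False
    have hH: "h \<in> fns H" and h0H: "h0 \<in> fns H" using h h0 EH by auto
    have hpos: "hnorm H h > 0" using False hH hnorm_nonneg[OF hH] hnorm_eq_zero[OF hH] by simp
    \<comment> \<open>\<open>h\<close> scaled to norm \<open>e / 2\<close> is the difference of two points of the ball around \<open>h0\<close>.\<close>
    define t where "t = e / (2 * hnorm H h)"
    have t: "t > 0" using e hpos by (simp add: t_def)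
    let ?th = "cscale (complex_of_real t) h"
    have "h0 + ?th \<in> E"
      using h h0 mult_graph_add mult_graph_cscale unfolding E_def mult_dom_eq_Domain by blast
    moreover have "hdist H h0 (h0 + ?th) < e"
    proof -
      have "hdist H h0 (h0 + ?th) = hnorm H ?th"
        using hH h0H hnorm_diff_commute[of h0 "h0 + ?th"] by (simp add: hdist_hnorm)
      also have "\<dots> = t * hnorm H h" using hH t by (simp add: hnorm_cscale)
      also have "\<dots> < e" using e hpos by (simp add: t_def)
      finally show ?thesis .
    qed
    ultimately have "h0 + ?th \<in> F n" "h0 \<in> F n" using ball h0 e h0H by auto
    then have le: "norm (ip H (h0 + ?th) k) \<le> real n * hnorm H w" "norm (ip H h0 k) \<le> real n * hnorm H w"
      using wk by (auto simp: F_def)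
    have "t * norm (ip H h k) = norm (ip H (h0 + ?th) k - ip H h0 k)"
      using hH h0H adj(2)[OF wk] t by (simp add: ip_add ip_scale norm_mult)
    also have "\<dots> \<le> 2 * real n * hnorm H w"
      using le norm_triangle_ineq4[of "ip H (h0 + ?th) k" "ip H h0 k"] by simp
    finally show ?thesis using hpos e by (simp add: t_def field_simps)
  qed
  show ?thesis
  proof (rule that)
    show "0 \<le> 4 * real n / e" using e by simp
  qed (use bound in \<open>simp add: E_def\<close>)
qed

text \<open>The bound passes from the vectors \<open>w\<close> in the domain of the adjoint to their limits, hence to
  \<open>w = g\<close>.\<close>

lemma mult_graph_bounded:
  obtains C where "0 \<le> C" "\<And>h g. (h, g) \<in> mult_graph H \<phi> \<Longrightarrow> hnorm H g \<le> C * hnorm H h"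
proof -
  obtain C where C: "0 \<le> C"
    "\<And>h w k. h \<in> mult_dom H \<phi> \<Longrightarrow> (w, k) \<in> adjoint_graph H \<phi> \<Longrightarrow>
      norm (ip H h k) \<le> C * hnorm H h * hnorm H w"
    using adjoint_graph_bound by blast
  have "hnorm H g \<le> C * hnorm H h" if hg: "(h, g) \<in> mult_graph H \<phi>" for h g
  proof -
    note H = mult_graph_mem[OF hg]
    define T where "T = {w \<in> fns H. norm (ip H w g) \<le> C * hnorm H h * hnorm H w + 0}"
    have "Domain (adjoint_graph H \<phi>) \<subseteq> T"
    proof
      fix w assume "w \<in> Domain (adjoint_graph H \<phi>)"
      then obtain k where wk: "(w, k) \<in> adjoint_graph H \<phi>" by blast
      then have w: "w \<in> fns H" and eq: "ip H g w = ip H h k"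
        using hg by (auto simp: adjoint_graph_def)
      have "h \<in> mult_dom H \<phi>" using hg unfolding mult_dom_eq_Domain by blast
      then show "w \<in> T"
        using C(2)[OF _ wk] eq w norm_ip_commute[OF w H(2)] by (simp add: T_def)
    qed
    moreover have "closedin (htop H) T" unfolding T_def by (rule closedin_norm_ip_le[OF H(2)])
    ultimately have "fns H \<subseteq> T"
      using closure_of_minimal[of _ T "htop H"] closure_Domain_adjoint_graph by blast
    then have "norm (ip H g g) \<le> C * hnorm H h * hnorm H g" using H by (auto simp: T_def)
    then have "hnorm H g * hnorm H g \<le> C * hnorm H h * hnorm H g"
      using H by (simp add: ip_self power2_eq_square norm_mult hnorm_nonneg)
    moreover have "0 \<le> C * hnorm H h" using C(1) H by (simp add: hnorm_nonneg)
    ultimately show ?thesis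
      using hnorm_nonneg[OF H(2)] by (cases "hnorm H g = 0") auto
  qed
  then show ?thesis using that C(1) by blast
qed

end
section \<open>Seen, ambiguous and definable vectors\<close>

lemma extend_fn_simps [simp]:
  "extend_fn H v f None = ip H f v" "extend_fn H v f (Some x) = f x"
  "extend_fn H v f \<circ> Some = f"
  by (auto simp: extend_fn_def)

lemma extend_space_simps [simp]:
  "pts (extend_space H v) = insert None (Some ` pts H)"
  "fns (extend_space H v) = extend_fn H v ` fns H"
  "ip (extend_space H v) F G = ip H (F \<circ> Some) (G \<circ> Some)"
  by (auto simp: extend_space_def)

context hilbert_function_space
begin

lemma hdist_extend:
  assumes "f \<in> fns H" "g \<in> fns H"
  shows "hdist (extend_space H v) (extend_fn H v f) (extend_fn H v g) = hdist H f g"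
proof -
  have "(extend_fn H v f - extend_fn H v g) \<circ> Some = f - g" by (auto simp: fun_eq_iff)
  then show ?thesis using assms by (simp add: hdist_def)
qed

lemma metric_space_extend: "Metric_space (fns (extend_space H v)) (hdist (extend_space H v))"
proof
  fix F G K
  show "0 \<le> hdist (extend_space H v) F G"
  proof (cases "F \<in> fns (extend_space H v) \<and> G \<in> fns (extend_space H v)")
    case True
    then show ?thesis using hdist_extend nonneg by auto
  qed (auto simp: hdist_def)
  show "hdist (extend_space H v) F G = hdist (extend_space H v) G F"
  proof (cases "F \<in> fns (extend_space H v) \<and> G \<in> fns (extend_space H v)")
    case True
    then show ?thesis using hdist_extend commute by auto
  qed (auto simp: hdist_def)
  assume "F \<in> fns (extend_space H v)" "G \<in> fns (extend_space H v)"
  then obtain f g where fg: "f \<in> fns H" "g \<in> fns H" "F = extend_fn H v f" "G = extend_fn H v g"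
    by auto
  have "F = G \<longleftrightarrow> f = g" unfolding fg by (metis extend_fn_simps(3))
  then show "hdist (extend_space H v) F G = 0 \<longleftrightarrow> F = G"
    using fg hdist_extend by auto
  assume "K \<in> fns (extend_space H v)"
  then obtain k where "k \<in> fns H" "K = extend_fn H v k" by auto
  then show "hdist (extend_space H v) F K \<le> hdist (extend_space H v) F G + hdist (extend_space H v) G K"
    using fg hdist_extend triangle by simp
qed

lemma closedin_extend:
  assumes "closedin (htop H) V"
  shows "closedin (htop (extend_space H v)) (extend_fn H v ` V)"
proof -
  interpret X: Metric_space "fns (extend_space H v)" "hdist (extend_space H v)"
    by (rule metric_space_extend)
  have V: "V \<subseteq> fns H" using closedin_subset[OF assms] by simp
  show ?thesis
    unfolding X.closedin_metric
  proof (intro conjI allI impI)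
    show "extend_fn H v ` V \<subseteq> fns (extend_space H v)" using V by auto
    fix F assume "F \<in> fns (extend_space H v) - extend_fn H v ` V"
    then obtain f where f: "f \<in> fns H" "f \<notin> V" "F = extend_fn H v f" by auto
    then obtain r where r: "r > 0" "disjnt V (mball f r)"
      using assms unfolding closedin_metric by blast
    have "disjnt (extend_fn H v ` V) (X.mball F r)"
      unfolding disjnt_iff
    proof (intro allI notI, elim conjE)
      fix G assume "G \<in> extend_fn H v ` V" "G \<in> X.mball F r"
      then obtain g where g: "g \<in> V" "hdist (extend_space H v) F (extend_fn H v g) < r"
        unfolding X.in_mball by blast
      then have "g \<in> mball f r" using f V hdist_extend by auto
      then show False using r(2) g(1) by (auto simp: disjnt_iff)
    qed
    then show "\<exists>r>0. disjnt (extend_fn H v ` V) (X.mball F r)" using r(1) by blast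
  qed
qed

lemma finite_codimension_extend:
  assumes v: "v \<in> fns H" and V: "V \<subseteq> fns H" and fin: "finite_codimension H V"
  shows "finite_codimension (extend_space H v) (extend_fn H v ` V)"
proof -
  obtain B where B: "finite B" "B \<subseteq> fns H" "fns H \<subseteq> cfun.span (V \<union> B)"
    using fin unfolding finite_codimension_def by blast
  let ?S = "extend_fn H v ` V \<union> extend_fn H v ` B"
  define T where "T = {f \<in> fns H. extend_fn H v f \<in> cfun.span ?S}"
  have add: "extend_fn H v (f + g) = extend_fn H v f + extend_fn H v g"
    if "f \<in> fns H" "g \<in> fns H" for f g
    using that v by (auto simp: extend_fn_def fun_eq_iff ip_add split: option.split)
  have scale: "extend_fn H v (cscale c f) = cscale c (extend_fn H v f)" if "f \<in> fns H" for c f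
    using that v ip_scale[of f v c] by (auto simp: extend_fn_def cscale_def fun_eq_iff split: option.split)
  have zero: "extend_fn H v 0 = 0"
    using v by (auto simp: extend_fn_def fun_eq_iff split: option.split)
  have "cfun.subspace T"
    unfolding cfun.subspace_def T_def
    by (auto simp: add scale zero intro: cfun.span_add cfun.span_scale cfun.span_zero)
  moreover have "V \<union> B \<subseteq> T"
    using V B by (auto simp: T_def intro: cfun.span_base)
  ultimately have "cfun.span (V \<union> B) \<subseteq> T" by (intro cfun.span_minimal)
  then have "fns (extend_space H v) \<subseteq> cfun.span ?S" using B(3) by (auto simp: T_def)
  moreover have "finite (extend_fn H v ` B)" "extend_fn H v ` B \<subseteq> fns (extend_space H v)"
    using B by auto
  ultimately show ?thesis unfolding finite_codimension_def by blast
qed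

end

context hilbert_function_space_pseudomultiplier
begin

text \<open>Seeing \<open>v\<close> with value \<open>c\<close> says that \<open>\<phi>\<close> multiplies the values \<open>\<langle>h, v\<rangle>\<close> at the new point by
  \<open>c\<close>. When it does, \<open>\<phi>\<close> extended by \<open>c\<close> at the new point alone is a witness. In terms of the
  adjoint, \<open>v\<close> is an eigenvector modulo the singular space.\<close>

lemma sees_with_value_iff:
  assumes v: "v \<in> fns H"
  shows "sees_with_value H \<phi> v c \<longleftrightarrow> (\<forall>(h, g)\<in>mult_graph H \<phi>. ip H g v = c * ip H h v)"
proof
  assume "sees_with_value H \<phi> v c"
  then obtain \<psi> where ext: "\<And>x. x \<in> dom \<phi> \<Longrightarrow> \<psi> (Some x) = \<phi> x"
    and E: "mult_dom H \<phi> = (\<lambda>F. F \<circ> Some) ` mult_dom (extend_space H v) \<psi>"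
    and c: "\<psi> None = Some c"
    unfolding sees_with_value_def by blast
  have "ip H g v = c * ip H h v" if hg: "(h, g) \<in> mult_graph H \<phi>" for h g
  proof -
    have "h \<in> mult_dom H \<phi>" using hg unfolding mult_dom_eq_Domain by blast
    then obtain F where F: "h = F \<circ> Some" "F \<in> mult_dom (extend_space H v) \<psi>"
      unfolding E by blast
    then obtain G where F': "F \<in> fns (extend_space H v)" and G: "G \<in> fns (extend_space H v)"
      and eq: "\<And>y. y \<in> dom \<psi> \<Longrightarrow> G y = the (\<psi> y) * F y"
      unfolding mult_dom_def by blast
    from F(1) F' G obtain g' where Fh: "F = extend_fn H v h" and g': "g' \<in> fns H" "G = extend_fn H v g'"
      by auto
    have "g' = g"
    proof (rule eq_on_dom_imp_eq[OF g'(1) mult_graph_mem(2)[OF hg]])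
      fix x assume x: "x \<in> dom \<phi>"
      then have "Some x \<in> dom \<psi>" using ext[OF x] by auto
      then have "g' x = the (\<phi> x) * h x" using eq[of "Some x"] ext[OF x] g'(2) Fh by simp
      then show "g' x = g x" using hg x by (auto simp: mult_graph_def)
    qed
    then show ?thesis using eq[of None] c g'(2) Fh by (auto simp: dom_def)
  qed
  then show "\<forall>(h, g)\<in>mult_graph H \<phi>. ip H g v = c * ip H h v" by blast
next
  assume eig: "\<forall>(h, g)\<in>mult_graph H \<phi>. ip H g v = c * ip H h v"
  define \<psi> where "\<psi> = case_option (Some c) \<phi>"
  have \<psi>: "\<psi> None = Some c" "\<psi> (Some x) = \<phi> x" for x by (auto simp: \<psi>_def)
  have dom: "dom \<psi> = insert None (Some ` dom \<phi>)"
  proof (rule set_eqI)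
    fix y show "y \<in> dom \<psi> \<longleftrightarrow> y \<in> insert None (Some ` dom \<phi>)"
      using \<psi> by (cases y) (auto simp: dom_def)
  qed
  have E: "mult_dom (extend_space H v) \<psi> = extend_fn H v ` mult_dom H \<phi>"
  proof (intro equalityI subsetI)
    fix F assume "F \<in> mult_dom (extend_space H v) \<psi>"
    then obtain f g where "f \<in> fns H" "F = extend_fn H v f" "g \<in> fns H"
      "\<forall>y\<in>dom \<psi>. extend_fn H v g y = the (\<psi> y) * extend_fn H v f y"
      unfolding mult_dom_def by auto
    then show "F \<in> extend_fn H v ` mult_dom H \<phi>"
      unfolding mult_dom_def dom by (auto simp: \<psi>)
  next
    fix F assume "F \<in> extend_fn H v ` mult_dom H \<phi>"
    then obtain h g where hg: "(h, g) \<in> mult_graph H \<phi>" "F = extend_fn H v h"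
      unfolding mult_dom_eq_Domain by blast
    moreover have "\<forall>y\<in>dom \<psi>. extend_fn H v g y = the (\<psi> y) * extend_fn H v h y"
      using hg eig unfolding dom by (auto simp: \<psi> mult_graph_def)
    ultimately show "F \<in> mult_dom (extend_space H v) \<psi>"
      unfolding mult_dom_def using mult_graph_mem[OF hg(1)] by auto
  qed
  have EH: "mult_dom H \<phi> \<subseteq> fns H" by (auto simp: mult_dom_def)
  have "uniqueness_set (extend_space H v) (dom \<psi>)"
    unfolding uniqueness_set_def
  proof (intro conjI ballI impI)
    show "dom \<psi> \<subseteq> pts (extend_space H v)" using dom_subset_pts by (auto simp: dom)
    fix F G assume FG: "F \<in> fns (extend_space H v)" "G \<in> fns (extend_space H v)"
      and eq: "\<forall>y\<in>dom \<psi>. F y = G y"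
    then obtain f g where fg: "f \<in> fns H" "g \<in> fns H" "F = extend_fn H v f" "G = extend_fn H v g"
      by auto
    then have "f = g" using eq dom by (intro eq_on_dom_imp_eq) auto
    then show "F = G" using fg by simp
  qed
  moreover have "finite_codimension H (mult_dom H \<phi>)"
    using pseudomultiplier unfolding pseudomultiplier_def by blast
  ultimately have "pseudomultiplier (extend_space H v) \<psi>"
    unfolding pseudomultiplier_def E
    using closedin_extend[OF closedin_mult_dom] finite_codimension_extend[OF v EH] by blast
  moreover have "mult_dom H \<phi> = (\<lambda>F. F \<circ> Some) ` mult_dom (extend_space H v) \<psi>"
    unfolding E by (simp add: image_image)
  ultimately show "sees_with_value H \<phi> v c"
    unfolding sees_with_value_def using \<psi> by blast
qed

lemma Field_mult_graph: "Field (mult_graph H \<phi>) \<subseteq> fns H"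
  using mult_graph_mem by (auto simp: Field_def)

text \<open>An eigenvector for two different eigenvalues is orthogonal to the domain and to the range of
  the operator.\<close>

lemma two_values_imp_orth:
  assumes v: "v \<in> fns H" and "sees_with_value H \<phi> v c" "sees_with_value H \<phi> v c'" "c \<noteq> c'"
  shows "v \<in> orth_complement H (Field (mult_graph H \<phi>))"
proof -
  have "ip H h v = 0 \<and> ip H g v = 0" if "(h, g) \<in> mult_graph H \<phi>" for h g
  proof -
    have "ip H g v = c * ip H h v" "ip H g v = c' * ip H h v"
      using assms that by (auto simp: sees_with_value_iff)
    then show ?thesis using \<open>c \<noteq> c'\<close> by auto
  qed
  then show ?thesis
    using v mult_graph_mem by (auto simp: orth_complement_def Field_def ip_eq_zero_sym)
qed

lemma ambiguous_vectors_eq: "ambiguous_vectors H \<phi> = orth_complement H (Field (mult_graph H \<phi>))"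
proof (intro equalityI subsetI)
  fix v assume "v \<in> ambiguous_vectors H \<phi>"
  then show "v \<in> orth_complement H (Field (mult_graph H \<phi>))"
    using two_values_imp_orth[of v 0 1] by (auto simp: ambiguous_vectors_def)
next
  fix v assume v: "v \<in> orth_complement H (Field (mult_graph H \<phi>))"
  then have vH: "v \<in> fns H" by (simp add: orth_complement_def)
  have "ip H h v = 0 \<and> ip H g v = 0" if hg: "(h, g) \<in> mult_graph H \<phi>" for h g
  proof -
    have "ip H v h = 0" "ip H v g = 0"
      using v hg by (auto simp: orth_complement_def Field_def)
    then show ?thesis using vH mult_graph_mem[OF hg] by (simp add: ip_eq_zero_sym)
  qed
  then show "v \<in> ambiguous_vectors H \<phi>"
    using vH by (auto simp: ambiguous_vectors_def sees_with_value_iff)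
qed

lemma vector_value_eq:
  assumes d: "d \<in> definable_vectors H \<phi>" and c: "sees_with_value H \<phi> d c"
  shows "vector_value H \<phi> d = c"
  unfolding vector_value_def
proof (rule the_equality[where P = "sees_with_value H \<phi> d", OF c])
  have dH: "d \<in> fns H" "d \<noteq> 0" "\<forall>a\<in>ambiguous_vectors H \<phi>. ip H d a = 0"
    using d by (auto simp: definable_vectors_def)
  fix c' assume "sees_with_value H \<phi> d c'"
  then have "d \<in> ambiguous_vectors H \<phi>" if "c' \<noteq> c"
    unfolding ambiguous_vectors_eq using two_values_imp_orth dH(1) c that by blast
  then show "c' = c" using dH ip_definite by blast
qed

lemma definable_vector_eigen:
  assumes d: "d \<in> definable_vectors H \<phi>" and hg: "(h, g) \<in> mult_graph H \<phi>"
  shows "ip H g d = vector_value H \<phi> d * ip H h d"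
proof -
  obtain c where c: "sees_with_value H \<phi> d c" and "d \<in> fns H"
    using d by (auto simp: definable_vectors_def)
  then show ?thesis using vector_value_eq[OF d c] hg by (auto simp: sees_with_value_iff)
qed

section \<open>Polar vectors\<close>

text \<open>For a definable vector \<open>d\<close> with value \<open>c\<close>, the eigenvalue equation reads
  \<open>\<langle>h, d\<rangle> = \<langle>g, d\<rangle> / c\<close>, and the right-hand side tends to \<open>0\<close> along a sequence with \<open>c \<rightarrow> \<infinity>\<close>.\<close>

lemma polar_vector_orth:
  assumes "polar_vector H \<phi> q"
  shows "q \<in> singular_space H \<phi>" "q \<in> orth_complement H (ambiguous_vectors H \<phi>)"
proof -
  obtain d where q: "q \<in> fns H" and d: "\<And>n. d n \<in> definable_vectors H \<phi>"
    and lim: "limitin (htop H) d q sequentially"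
    and inf: "filterlim (\<lambda>n. vector_value H \<phi> (d n)) at_infinity sequentially"
    using assms unfolding polar_vector_def by blast
  have dH: "d n \<in> fns H" for n using d by (auto simp: definable_vectors_def)
  have "ip H q h = 0" if hg: "(h, g) \<in> mult_graph H \<phi>" for h g
  proof -
    note H = mult_graph_mem[OF hg]
    have "(\<lambda>n. cnj (ip H (d n) g) / vector_value H \<phi> (d n)) \<longlonglongrightarrow> 0"
      by (rule tendsto_divide_0[OF tendsto_cnj[OF tendsto_ip[OF lim H(2)]] inf])
    moreover have "eventually (\<lambda>n. vector_value H \<phi> (d n) \<noteq> 0) sequentially"
      using inf by (rule filterlim_at_infinity_imp_eventually_ne)
    then have "eventually (\<lambda>n. cnj (ip H (d n) g) / vector_value H \<phi> (d n) = cnj (ip H (d n) h))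
        sequentially"
    proof eventually_elim
      case (elim n)
      then show ?case
        using definable_vector_eigen[OF d hg] ip_cnj[OF dH H(1)] ip_cnj[OF dH H(2)] by simp
    qed
    ultimately have "(\<lambda>n. cnj (ip H (d n) h)) \<longlonglongrightarrow> 0"
      by (simp add: filterlim_cong)
    moreover have "(\<lambda>n. cnj (ip H (d n) h)) \<longlonglongrightarrow> cnj (ip H q h)"
      by (rule tendsto_cnj[OF tendsto_ip[OF lim H(1)]])
    ultimately show ?thesis using LIMSEQ_unique by fastforce
  qed
  then show "q \<in> singular_space H \<phi>"
    using q by (auto simp: singular_space_def orth_complement_def mult_dom_eq_Domain)
  have "ip H q a = 0" if a: "a \<in> ambiguous_vectors H \<phi>" for a
  proof -
    have "a \<in> fns H" using a by (simp add: ambiguous_vectors_def)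
    from tendsto_ip[OF lim this] have "(\<lambda>n. 0 :: complex) \<longlonglongrightarrow> ip H q a"
      using d a by (simp add: definable_vectors_def)
    then show ?thesis using LIMSEQ_unique tendsto_const by blast
  qed
  then show "q \<in> orth_complement H (ambiguous_vectors H \<phi>)"
    using q by (auto simp: orth_complement_def)
qed

text \<open>The vectors seen with value \<open>c\<close> form the orthogonal complement of the space \<open>R\<close> of all
  \<open>g - c * h\<close> with \<open>(h, g)\<close> in the graph. As \<open>q\<close> is orthogonal to \<open>h\<close>, its inner product with
  \<open>g - c * h\<close> is \<open>\<langle>g, q\<rangle>\<close>, of size at most \<open>C * \<parallel>h\<parallel> * \<parallel>q\<parallel>\<close>, while \<open>g - c * h\<close> has norm at least
  \<open>(\<bar>c\<bar> - C) * \<parallel>h\<parallel>\<close>. For large \<open>c\<close> the projection of \<open>q\<close> to the closure of \<open>R\<close> is therefore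
  small, and removing it from \<open>q\<close> gives a definable vector close to \<open>q\<close>.\<close>

lemma exists_definable_near:
  assumes qS: "q \<in> singular_space H \<phi>" and qA: "q \<in> orth_complement H (ambiguous_vectors H \<phi>)"
    and q0: "q \<noteq> 0" and e: "e > 0"
  obtains d where "d \<in> definable_vectors H \<phi>" "hdist H d q < e" "norm (vector_value H \<phi> d) \<ge> b"
proof -
  have q: "q \<in> fns H" using qS by (auto simp: singular_space_def orth_complement_def)
  have qpos: "hnorm H q > 0" using q q0 hnorm_nonneg hnorm_eq_zero by (simp add: order_less_le)
  obtain C where C: "0 \<le> C" "\<And>h g. (h, g) \<in> mult_graph H \<phi> \<Longrightarrow> hnorm H g \<le> C * hnorm H h"
    using mult_graph_bounded by blast
  \<comment> \<open>\<open>s\<close> will bound the norm of the projection \<open>r\<close>: below \<open>e\<close> for nearness, and below \<open>\<parallel>q\<parallel>\<close> to keep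
    \<open>q - r\<close> nonzero.\<close>
  define s where "s = min e (hnorm H q) / 2"
  have s: "s > 0" "s < e" "s < hnorm H q" using e qpos by (auto simp: s_def)
  define t where "t = max b (C + C * hnorm H q / s + 1)"
  have "C * hnorm H q / s < t - C" by (simp add: t_def)
  then have t: "C * hnorm H q \<le> s * (t - C)" using s(1) by (simp add: field_simps)
  have tC: "0 < t - C"
    using \<open>C * hnorm H q / s < t - C\<close> C(1) qpos s(1) by (smt (verit) divide_nonneg_pos mult_nonneg_nonneg)
  define c where "c = complex_of_real t"
  have cn: "norm c = t" using tC C(1) by (simp add: c_def)
  define R where "R = {g - cscale c h |h g. (h, g) \<in> mult_graph H \<phi>}"
  have RH: "R \<subseteq> fns H" using mult_graph_mem by (auto simp: R_def)
  have subR: "cfun.subspace R"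
    unfolding cfun.subspace_def
  proof (intro conjI allI ballI)
    have "0 = 0 - cscale c 0" by simp
    then show "0 \<in> R" unfolding R_def using mult_graph_zero by blast
  next
    fix x y assume "x \<in> R" "y \<in> R"
    then obtain h g h' g' where "(h, g) \<in> mult_graph H \<phi>" "(h', g') \<in> mult_graph H \<phi>"
      and xy: "x = g - cscale c h" "y = g' - cscale c h'" unfolding R_def by blast
    then have "(h + h', g + g') \<in> mult_graph H \<phi>" using mult_graph_add by blast
    moreover have "x + y = (g + g') - cscale c (h + h')"
      unfolding xy by (simp add: cfun.scale_right_distrib)
    ultimately show "x + y \<in> R" unfolding R_def by blast
  next
    fix a x assume "x \<in> R"
    then obtain h g where "(h, g) \<in> mult_graph H \<phi>" and x: "x = g - cscale c h"
      unfolding R_def by blast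
    then have "(cscale a h, cscale a g) \<in> mult_graph H \<phi>" using mult_graph_cscale by blast
    moreover have "cscale a x = cscale a g - cscale c (cscale a h)"
      unfolding x by (simp add: cfun.scale_right_diff_distrib cfun.scale_left_commute)
    ultimately show "cscale a x \<in> R" unfolding R_def by blast
  qed
  obtain r where r: "r \<in> htop H closure_of R" "r \<in> fns H" "\<And>y. y \<in> R \<Longrightarrow> ip H (q - r) y = 0"
    using projection_closure[OF subR RH q] by blast
  define d where "d = q - r"
  have d: "d \<in> fns H" using q r by (simp add: d_def)

  \<comment> \<open>Two properties of \<open>R\<close> pass to its closure, hence to \<open>r\<close>.\<close>
  have "R \<subseteq> {f \<in> fns H. norm (ip H f q) \<le> s * hnorm H f + 0}"
  proof
    fix y assume "y \<in> R"
    then obtain h g where hg: "(h, g) \<in> mult_graph H \<phi>" and y: "y = g - cscale c h"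
      unfolding R_def by blast
    note H = mult_graph_mem[OF hg]
    have yH: "y \<in> fns H" using H y by simp
    have "ip H q h = 0"
      using qS hg by (auto simp: singular_space_def orth_complement_def mult_dom_eq_Domain)
    then have "ip H h q = 0" using q H by (simp add: ip_eq_zero_sym)
    then have "norm (ip H y q) = norm (ip H g q)"
      using H q by (simp add: y ip_diff ip_scale)
    also have "\<dots> \<le> hnorm H g * hnorm H q" by (rule cauchy_schwarz[OF H(2) q])
    also have "\<dots> \<le> (C * hnorm H h) * hnorm H q"
      using C(2)[OF hg] qpos by (intro mult_right_mono) auto
    also have "\<dots> = (C * hnorm H q) * hnorm H h" by simp
    also have "\<dots> \<le> (s * (t - C)) * hnorm H h"
      using t hnorm_nonneg[OF H(1)] by (rule mult_right_mono)
    also have "\<dots> \<le> s * hnorm H y"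
    proof -
      have "t * hnorm H h = hnorm H (cscale c h)" using H cn by (simp add: hnorm_cscale)
      also have "\<dots> \<le> hnorm H g + hnorm H (cscale c h - g)"
        using hnorm_triangle[of g "cscale c h - g"] H by simp
      also have "hnorm H (cscale c h - g) = hnorm H y"
        unfolding y using hnorm_diff_commute[of g "cscale c h"] H by simp
      finally have "(t - C) * hnorm H h \<le> hnorm H y"
        using C(2)[OF hg] by (simp add: algebra_simps)
      then show ?thesis using s(1) by (simp add: mult.assoc)
    qed
    finally show "y \<in> {f \<in> fns H. norm (ip H f q) \<le> s * hnorm H f + 0}" using yH by simp
  qed
  then have "htop H closure_of R \<subseteq> {f \<in> fns H. norm (ip H f q) \<le> s * hnorm H f + 0}"
    by (rule closure_of_minimal[OF _ closedin_norm_ip_le[OF q]])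
  then have rq: "norm (ip H r q) \<le> s * hnorm H r" using r(1) by auto
  have perp: "ip H r k = 0" if k: "k \<in> fns H" "\<And>y. y \<in> R \<Longrightarrow> ip H y k = 0" for k
  proof -
    have "R \<subseteq> {f \<in> fns H. norm (ip H f k) \<le> 0 * hnorm H f + 0}" using RH k by auto
    then have "htop H closure_of R \<subseteq> {f \<in> fns H. norm (ip H f k) \<le> 0 * hnorm H f + 0}"
      by (rule closure_of_minimal[OF _ closedin_norm_ip_le[OF k(1)]])
    then show ?thesis using r(1) by auto
  qed
  have rd: "ip H r d = 0"
    using perp[OF d] r(3) RH d ip_eq_zero_sym unfolding d_def by blast
  have "ip H r q = ip H r r"
    using rd q r(2) by (simp add: d_def ip_diff_right)
  then have "(hnorm H r)\<^sup>2 \<le> s * hnorm H r" using rq r(2) by (simp add: ip_self norm_power)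
  then have rs: "hnorm H r \<le> s"
    using hnorm_nonneg[OF r(2)] s(1) by (cases "hnorm H r = 0") (auto simp: power2_eq_square)
  have "hdist H d q = hnorm H r"
    using d q hnorm_diff_commute[of d q] by (simp add: hdist_hnorm) (simp add: d_def)
  then have near: "hdist H d q < e" using rs s by simp
  have "d \<noteq> 0" using rs s by (auto simp: d_def)
  moreover have "ip H d a = 0" if a: "a \<in> ambiguous_vectors H \<phi>" for a
  proof -
    have aH: "a \<in> fns H" using a by (simp add: ambiguous_vectors_def)
    have "ip H y a = 0" if "y \<in> R" for y
    proof -
      obtain h g where hg: "(h, g) \<in> mult_graph H \<phi>" and y: "y = g - cscale c h"
        using \<open>y \<in> R\<close> unfolding R_def by blast
      note H = mult_graph_mem[OF hg]
      have "ip H a h = 0" "ip H a g = 0"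
        using a hg unfolding ambiguous_vectors_eq by (auto simp: orth_complement_def Field_def)
      then have "ip H h a = 0" "ip H g a = 0" using aH H by (simp_all add: ip_eq_zero_sym)
      then show ?thesis using H aH by (simp add: y ip_diff ip_scale)
    qed
    then have "ip H r a = 0" using perp aH by blast
    moreover have "ip H q a = 0" using qA a by (simp add: orth_complement_def)
    ultimately show ?thesis using q r(2) aH by (simp add: d_def ip_diff)
  qed
  moreover have sees: "sees_with_value H \<phi> d c"
  proof -
    have "ip H g d = c * ip H h d" if hg: "(h, g) \<in> mult_graph H \<phi>" for h g
    proof -
      note H = mult_graph_mem[OF hg]
      have "ip H d (g - cscale c h) = 0" using r(3) hg unfolding d_def R_def by blast
      then have "ip H (g - cscale c h) d = 0" using d H by (simp add: ip_eq_zero_sym)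
      then show ?thesis using d H by (simp add: ip_diff ip_scale)
    qed
    then show ?thesis using d by (auto simp: sees_with_value_iff)
  qed
  ultimately have def: "d \<in> definable_vectors H \<phi>"
    using d unfolding definable_vectors_def by blast
  then have "norm (vector_value H \<phi> d) \<ge> b"
    using vector_value_eq[OF def sees] cn by (simp add: t_def)
  then show ?thesis using that def near by blast
qed

lemma polar_space_eq:
  "polar_space H \<phi> = orth_complement H (mult_dom H \<phi> \<union> ambiguous_vectors H \<phi>)"
proof -
  have AH: "ambiguous_vectors H \<phi> \<subseteq> fns H" by (auto simp: ambiguous_vectors_def)
  have "polar_vector H \<phi> q"
    if qS: "q \<in> singular_space H \<phi>" and qA: "q \<in> orth_complement H (ambiguous_vectors H \<phi>)"
      and q0: "q \<noteq> 0" for q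
  proof -
    have q: "q \<in> fns H" using qA by (auto simp: orth_complement_def)
    have "\<exists>d. d \<in> definable_vectors H \<phi> \<and> hdist H d q < 1 / Suc n \<and>
        norm (vector_value H \<phi> d) \<ge> real n" for n
    proof -
      have "1 / real (Suc n) > 0" by simp
      from exists_definable_near[OF qS qA q0 this, of "real n"] show ?thesis by blast
    qed
    then obtain d where d: "\<And>n. d n \<in> definable_vectors H \<phi>"
      "\<And>n. hdist H (d n) q < 1 / Suc n" "\<And>n. norm (vector_value H \<phi> (d n)) \<ge> real n"
      by metis
    have dH: "d n \<in> fns H" for n using d(1) by (auto simp: definable_vectors_def)
    have "(\<lambda>n. hdist H (d n) q) \<longlonglongrightarrow> 0"
      by (rule tendsto_sandwich[OF _ _ tendsto_const LIMSEQ_Suc[OF lim_1_over_n]])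
        (use d(2) in \<open>auto intro: always_eventually less_imp_le\<close>)
    then have "limitin (htop H) d q sequentially"
      using q dH by (simp add: limitin_metric_dist_null)
    moreover have "filterlim (\<lambda>n. vector_value H \<phi> (d n)) at_infinity sequentially"
      by (rule filterlim_norm_at_top_imp_at_infinity)
        (rule filterlim_at_top_mono[OF filterlim_real_sequentially], use d(3) in simp)
    ultimately show ?thesis unfolding polar_vector_def using q q0 d(1) by blast
  qed
  moreover have "0 \<in> orth_complement H (mult_dom H \<phi> \<union> ambiguous_vectors H \<phi>)"
    using AH by (auto simp: orth_complement_def mult_dom_def)
  moreover have "orth_complement H (mult_dom H \<phi> \<union> ambiguous_vectors H \<phi>) =
      singular_space H \<phi> \<inter> orth_complement H (ambiguous_vectors H \<phi>)"
    by (auto simp: singular_space_def orth_complement_def)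
  ultimately show ?thesis
    using polar_vector_orth unfolding polar_space_def by blast
qed

text \<open>The ambiguous space is closed and lies in the singular space, so a singular vector minus its
  projection to the ambiguous space stays singular.\<close>

lemma singular_space_decomposition:
  "orthogonal_direct_sum H (singular_space H \<phi>) (polar_space H \<phi>) (ambiguous_vectors H \<phi>)"
proof -
  have AH: "ambiguous_vectors H \<phi> \<subseteq> fns H" by (auto simp: ambiguous_vectors_def)
  have EH: "mult_dom H \<phi> \<subseteq> fns H" by (auto simp: mult_dom_def)
  have A: "closed_subspace H (ambiguous_vectors H \<phi>)"
    unfolding ambiguous_vectors_eq by (rule closed_subspace_orth_complement[OF Field_mult_graph])
  have P: "closed_subspace H (polar_space H \<phi>)"
    unfolding polar_space_eq using AH EH by (intro closed_subspace_orth_complement) auto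
  have AS: "ambiguous_vectors H \<phi> \<subseteq> singular_space H \<phi>"
    unfolding ambiguous_vectors_eq
    by (auto simp: singular_space_def orth_complement_def mult_dom_eq_Domain Field_def)
  have PS: "polar_space H \<phi> \<subseteq> singular_space H \<phi>"
    by (auto simp: polar_space_eq singular_space_def orth_complement_def)
  have S: "cfun.subspace (singular_space H \<phi>)"
    using closed_subspace_orth_complement[OF EH]
    by (simp add: singular_space_def closed_subspace_def)
  have "\<exists>f g. s = f + g \<and> f \<in> polar_space H \<phi> \<and> g \<in> ambiguous_vectors H \<phi>"
    if s: "s \<in> singular_space H \<phi>" for s
  proof -
    have sH: "s \<in> fns H" using s by (simp add: singular_space_def orth_complement_def)
    have "htop H closure_of ambiguous_vectors H \<phi> = ambiguous_vectors H \<phi>"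
      using A closure_of_closedin unfolding closed_subspace_def by blast
    then obtain r where r: "r \<in> ambiguous_vectors H \<phi>"
      "\<And>a. a \<in> ambiguous_vectors H \<phi> \<Longrightarrow> ip H (s - r) a = 0"
      using projection_closure[of "ambiguous_vectors H \<phi>" s] A sH unfolding closed_subspace_def
      by metis
    have "s - r \<in> singular_space H \<phi>"
      using cfun.subspace_diff[OF S s] r(1) AS by blast
    then have "s - r \<in> polar_space H \<phi>"
      using r(2) by (auto simp: polar_space_eq singular_space_def orth_complement_def)
    then show ?thesis using r(1) by (intro exI[of _ "s - r"] exI[of _ r]) simp
  qed
  moreover have "f + g \<in> singular_space H \<phi>"
    if "f \<in> polar_space H \<phi>" "g \<in> ambiguous_vectors H \<phi>" for f g
    using that AS PS cfun.subspace_add[OF S] by blast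
  moreover have "\<forall>f\<in>polar_space H \<phi>. \<forall>g\<in>ambiguous_vectors H \<phi>. ip H f g = 0"
    by (auto simp: polar_space_eq orth_complement_def)
  ultimately show ?thesis
    unfolding orthogonal_direct_sum_def using A P by blast
qed

end

theorem theorem2p22:
  fixes H :: "'a hfs" and \<phi> :: "'a \<rightharpoonup> complex"
  assumes "hilbert_function_space H"
    and "pseudomultiplier H \<phi>"
  shows "closed_subspace H (polar_space H \<phi>) \<and>
    orthogonal_direct_sum H (singular_space H \<phi>) (polar_space H \<phi>) (ambiguous_vectors H \<phi>)"
proof -
  interpret hilbert_function_space_pseudomultiplier H \<phi>
    using assms
    by (simp add: hilbert_function_space_pseudomultiplier_def
        hilbert_function_space_pseudomultiplier_axioms_def)
  show ?thesis
    using singular_space_decomposition by (simp add: orthogonal_direct_sum_def)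
qed

end
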